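(* For every c.e. set $A$ there is a collection $\mathcal{G}$ of c.e. sets generating $\mathcal{D}(A)$ which is of one of the following forms. Type 1: $\mathcal{G}=\{\emptyset\}$. Type 2: $\mathcal{G}=\{R\}$, $R$ an infinite computable set. Type 3: $\mathcal{G}=\{W\}$, $W$ an infinite noncomputable set. Type 4: $\mathcal{G}=\{R_0,R_1,\dots\}$, the $R_i$ infinite pairwise disjoint computable sets. Type 5: $\mathcal{G}=\{D_0,R_0,R_1,\dots\}$, $D_0$ the only noncomputable set and all sets infinite and pairwise disjoint. Type 6: $\mathcal{G}=\{D_0,D_1,\dots\}$, the $D_i$ infinite pairwise disjoint noncomputable sets. Type 7: $\mathcal{G}=\{D_0,R_0,R_1,\dots\}$, $D_0$ the only noncomputable set, the $R_i$ infinite pairwise disjoint computable sets, and $D_0\cap R_i\neq\emptyset$ for infinitely many $i$. Type 8: $\mathcal{G}=\{D_0,D_1,\dots,R_0,R_1,\dots\}$, the $D_i$ pairwise disjoint noncomputable sets and the $R_i$ infinite pairwise disjoint computable sets. Type 9: $\mathcal{G}=\{D_0,D_1,\dots,R_0,R_1,\dots\}$, the $R_i$ infinite pairwise disjoint computable sets and the $D_i$ infinite noncomputable sets with $D_l\subseteq D_{l+1}$ such that for all $l\in\omega$, $D_{l+1}-D_l$ is not c.e. and there are infinitely many $j$ with $R_j-D_l$ infinite. Type 10: $\mathcal{G}=\{D_0,D_1,\dots\}$, the $D_i$ infinite noncomputable sets with $D_l\subseteq D_{l+1}$ and $D_{l+1}-D_l$ not c.e. for all $l\in\omega$.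
   Context: All sets are c.e. subsets of $\omega$. $X\subseteq^*Y$ means $X-Y$ is finite. A (possibly finite or empty) collection $\mathcal{G}$ of c.e. sets generates $\mathcal{D}(A)$ if every member of $\mathcal{G}$ is disjoint from $A$ and for every c.e. set $D$ disjoint from $A$ there is a finite subcollection of $\mathcal{G}$ whose union almost contains $D$ (i.e., $D\subseteq^*$ that union). *)

theory Defs
  imports Main "HOL-Library.Disjoint_Sets"
begin

text \<open>Computability on the natural numbers is introduced through Kleene's partial recursive
  functions: basic functions, composition, primitive recursion and unbounded minimization.
  Programs carry no arity; \<open>None\<close> means divergence, and it is also the result of applying
  \<open>Succ\<close>, \<open>Proj\<close> or \<open>PrimRec\<close> to an argument list of unsuitable length.  For every program
  and every fixed length of the argument list this yields an ordinary partial recursive function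
  of that number of arguments.\<close>

datatype recf =
    Zero
  | Succ
  | Proj nat
  | Comp recf "recf list"
  | PrimRec recf recf
  | Mu recf

fun eval :: "recf \<Rightarrow> nat list \<Rightarrow> nat option" where
  "eval Zero xs = Some 0"
| "eval Succ xs = (case xs of [x] \<Rightarrow> Some (Suc x) | _ \<Rightarrow> None)"
| "eval (Proj i) xs = (if i < length xs then Some (xs ! i) else None)"
| "eval (Comp f gs) xs =
     (if \<forall>g\<in>set gs. eval g xs \<noteq> None then eval f (map (\<lambda>g. the (eval g xs)) gs) else None)"
| "eval (PrimRec f g) xs =
     (case xs of
        [] \<Rightarrow> None
      | n # ys \<Rightarrow>
          rec_nat (eval f ys)
            (\<lambda>m r. case r of None \<Rightarrow> None | Some z \<Rightarrow> eval g (m # z # ys)) n)"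
| "eval (Mu f) xs =
     (if \<exists>n. eval f (n # xs) = Some 0 \<and> (\<forall>m<n. eval f (m # xs) \<noteq> None)
      then Some (LEAST n. eval f (n # xs) = Some 0) else None)"

definition ce :: "nat set \<Rightarrow> bool" where
  "ce A \<longleftrightarrow> (\<exists>f. A = {x. eval f [x] \<noteq> None})"

definition computable :: "nat set \<Rightarrow> bool" where
  "computable A \<longleftrightarrow> (\<exists>f. \<forall>x. eval f [x] = Some (if x \<in> A then 1 else 0))"

definition almost_subset :: "nat set \<Rightarrow> nat set \<Rightarrow> bool"  (infix "\<subseteq>\<^sup>*" 50) where
  "X \<subseteq>\<^sup>* Y \<longleftrightarrow> finite (X - Y)"

definition generates_D :: "nat set set \<Rightarrow> nat set \<Rightarrow> bool" where
  "generates_D G A \<longleftrightarrow>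
     (\<forall>W\<in>G. ce W \<and> W \<inter> A = {}) \<and>
     (\<forall>D. ce D \<and> D \<inter> A = {} \<longrightarrow> (\<exists>F. F \<subseteq> G \<and> finite F \<and> D \<subseteq>\<^sup>* \<Union>F))"

text \<open>The members of the collections below are not required to be c.e. by the types themselves;
  this is part of \<^const>\<open>generates_D\<close>.\<close>

definition type1 :: "nat set set \<Rightarrow> bool" where
  "type1 G \<longleftrightarrow> G = {{}}"

definition type2 :: "nat set set \<Rightarrow> bool" where
  "type2 G \<longleftrightarrow> (\<exists>R. G = {R} \<and> infinite R \<and> computable R)"

definition type3 :: "nat set set \<Rightarrow> bool" where
  "type3 G \<longleftrightarrow> (\<exists>W. G = {W} \<and> infinite W \<and> \<not> computable W)"

definition type4 :: "nat set set \<Rightarrow> bool" where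
  "type4 G \<longleftrightarrow> (\<exists>R :: nat \<Rightarrow> nat set. G = range R \<and>
     (\<forall>i. infinite (R i) \<and> computable (R i)) \<and> disjoint_family R)"

definition type5 :: "nat set set \<Rightarrow> bool" where
  "type5 G \<longleftrightarrow> (\<exists>D0 (R :: nat \<Rightarrow> nat set). G = insert D0 (range R) \<and>
     infinite D0 \<and> \<not> computable D0 \<and>
     (\<forall>i. infinite (R i) \<and> computable (R i)) \<and>
     disjoint_family R \<and> (\<forall>i. D0 \<inter> R i = {}))"

definition type6 :: "nat set set \<Rightarrow> bool" where
  "type6 G \<longleftrightarrow> (\<exists>D :: nat \<Rightarrow> nat set. G = range D \<and>
     (\<forall>i. infinite (D i) \<and> \<not> computable (D i)) \<and> disjoint_family D)"

definition type7 :: "nat set set \<Rightarrow> bool" where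
  "type7 G \<longleftrightarrow> (\<exists>D0 (R :: nat \<Rightarrow> nat set). G = insert D0 (range R) \<and>
     \<not> computable D0 \<and>
     (\<forall>i. infinite (R i) \<and> computable (R i)) \<and>
     disjoint_family R \<and> infinite {i. D0 \<inter> R i \<noteq> {}})"

definition type8 :: "nat set set \<Rightarrow> bool" where
  "type8 G \<longleftrightarrow> (\<exists>(D :: nat \<Rightarrow> nat set) (R :: nat \<Rightarrow> nat set). G = range D \<union> range R \<and>
     (\<forall>i. \<not> computable (D i)) \<and> disjoint_family D \<and>
     (\<forall>i. infinite (R i) \<and> computable (R i)) \<and> disjoint_family R)"

definition type9 :: "nat set set \<Rightarrow> bool" where
  "type9 G \<longleftrightarrow> (\<exists>(D :: nat \<Rightarrow> nat set) (R :: nat \<Rightarrow> nat set). G = range D \<union> range R \<and>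
     (\<forall>i. infinite (R i) \<and> computable (R i)) \<and> disjoint_family R \<and>
     (\<forall>l. infinite (D l) \<and> \<not> computable (D l)) \<and>
     (\<forall>l. D l \<subseteq> D (Suc l)) \<and>
     (\<forall>l. \<not> ce (D (Suc l) - D l) \<and> infinite {j. infinite (R j - D l)}))"

definition type10 :: "nat set set \<Rightarrow> bool" where
  "type10 G \<longleftrightarrow> (\<exists>D :: nat \<Rightarrow> nat set. G = range D \<and>
     (\<forall>l. infinite (D l) \<and> \<not> computable (D l)) \<and>
     (\<forall>l. D l \<subseteq> D (Suc l) \<and> \<not> ce (D (Suc l) - D l)))"

end

theory Submission
  imports Defs "HOL-Library.Countable_Set"
begin

text \<open>Call a c.e. set \<open>D\<close> disjoint from \<open>A\<close> good if \<open>D' - D\<close> is c.e. for every c.e. \<open>D'\<close> disjoint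
  from \<open>A\<close>; computable sets are good.  If every c.e. set disjoint from \<open>A\<close> has a good superset
  disjoint from \<open>A\<close>, then the differences of an increasing cofinal sequence of good sets are
  pairwise disjoint c.e. generators, and grouping them into finite blocks gives one of the types
  1 to 6.  Otherwise some \<open>W\<close> has no good superset, and an increasing cofinal sequence
  above \<open>W\<close> can be chosen so that it is of type 10.  Types 7 to 9 are thus never needed.

  Closure of the c.e. sets under union needs two computations run in parallel.  For this every
  program is replaced by total stage approximations, obtained by bounding the search in each
  \<^const>\<open>Mu\<close> by the stage; no universal program or coding of computations is involved.\<close>

section \<open>Total computable functions\<close>

text \<open>Programs carry no arity, so the promise is limited to lists of length \<open>k\<close>;
  hence \<open>F\<close> may be any HOL function that gives the right values on those lists.\<close>

definition tot :: "nat \<Rightarrow> (nat list \<Rightarrow> nat) \<Rightarrow> bool" where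
  "tot k F \<longleftrightarrow> (\<exists>p. \<forall>xs. length xs = k \<longrightarrow> eval p xs = Some (F xs))"

text \<open>Tuples of programs in the shape consumed by \<open>Comp\<close>: they compute the
  argument list of an outer program.\<close>

definition tot_list :: "nat \<Rightarrow> (nat list \<Rightarrow> nat list) \<Rightarrow> bool" where
  "tot_list k L \<longleftrightarrow> (\<exists>ps. \<forall>xs. length xs = k \<longrightarrow> map (\<lambda>p. eval p xs) ps = map Some (L xs))"

lemma tot_cong:
  assumes "tot k F" "\<And>xs. length xs = k \<Longrightarrow> F xs = G xs"
  shows "tot k G"
  using assms unfolding tot_def by metis

lemma tot_list_Nil: "tot_list k (\<lambda>xs. [])"
  unfolding tot_list_def by auto

lemma tot_list_Cons: "tot k F \<Longrightarrow> tot_list k L \<Longrightarrow> tot_list k (\<lambda>xs. F xs # L xs)"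
  unfolding tot_def tot_list_def
proof (elim exE)
  fix p ps
  assume "\<forall>xs. length xs = k \<longrightarrow> eval p xs = Some (F xs)"
    "\<forall>xs. length xs = k \<longrightarrow> map (\<lambda>p. eval p xs) ps = map Some (L xs)"
  then show "\<exists>ps. \<forall>xs. length xs = k \<longrightarrow> map (\<lambda>p. eval p xs) ps = map Some (F xs # L xs)"
    by (intro exI[of _ "p # ps"]) simp
qed

lemma tot_list_drop: "tot_list k (drop n)"
  unfolding tot_list_def
  by (intro exI[of _ "map Proj [n..<k]"]) (auto intro!: nth_equalityI)

lemma tot_list_id: "tot_list k (\<lambda>xs. xs)"
  using tot_list_drop[of k 0] by simp

lemma tot_list_map:
  "(\<And>g. g \<in> set gs \<Longrightarrow> tot k (F g)) \<Longrightarrow> tot_list k (\<lambda>xs. map (\<lambda>g. F g xs) gs)"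
  by (induction gs) (auto intro: tot_list_Nil tot_list_Cons)

lemma tot_comp:
  assumes "tot m F" "tot_list k L" "\<And>xs. length xs = k \<Longrightarrow> length (L xs) = m"
  shows "tot k (\<lambda>xs. F (L xs))"
proof -
  obtain p where p: "\<And>xs. length xs = m \<Longrightarrow> eval p xs = Some (F xs)"
    using assms(1) unfolding tot_def by blast
  obtain ps where ps: "\<And>xs. length xs = k \<Longrightarrow> map (\<lambda>p. eval p xs) ps = map Some (L xs)"
    using assms(2) unfolding tot_list_def by blast
  have "eval (Comp p ps) xs = Some (F (L xs))" if "length xs = k" for xs
  proof -
    \<comment> \<open>Read on the level of sets, the list equation for \<open>ps\<close> shows that
      every component is defined, as \<open>Comp\<close> demands.\<close>
    have "set (map (\<lambda>p. eval p xs) ps) \<subseteq> range Some"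
      unfolding ps[OF that] by auto
    then have def: "\<forall>g\<in>set ps. eval g xs \<noteq> None" by auto
    have "map (\<lambda>g. the (eval g xs)) ps = map the (map (\<lambda>p. eval p xs) ps)" by simp
    also have "\<dots> = L xs" unfolding ps[OF that] by (simp add: comp_def)
    finally show ?thesis using def p assms(3) that by simp
  qed
  then show ?thesis unfolding tot_def by blast
qed

lemma tot_nth: "i < k \<Longrightarrow> tot k (\<lambda>xs. xs ! i)"
  unfolding tot_def by (intro exI[of _ "Proj i"]) simp

lemma tot_Suc: "tot k F \<Longrightarrow> tot k (\<lambda>xs. Suc (F xs))"
proof -
  have "tot 1 (\<lambda>xs. Suc (xs ! 0))"
    unfolding tot_def by (intro exI[of _ Succ]) (auto simp: length_Suc_conv)
  moreover assume "tot k F"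
  ultimately show ?thesis
    using tot_comp[of 1 "\<lambda>xs. Suc (xs ! 0)" k "\<lambda>xs. [F xs]"]
    by (simp add: tot_list_Cons tot_list_Nil)
qed

lemma tot_const: "tot k (\<lambda>xs. c)"
proof (induction c)
  case 0
  show ?case unfolding tot_def by (intro exI[of _ Zero]) simp
qed (rule tot_Suc)

text \<open>\<open>PrimRec\<close> recurses on its first argument. Precomposing with
  \<open>N\<close> and \<open>L\<close> permits a computed number of rounds and computed parameters,
  in whatever order the outer arguments come.\<close>

lemma tot_rec:
  assumes F: "tot k F" and G: "tot (Suc (Suc k)) G"
    and N: "tot m N" and L: "tot_list m L" "\<And>xs. length xs = m \<Longrightarrow> length (L xs) = k"
  shows "tot m (\<lambda>xs. rec_nat (F (L xs)) (\<lambda>i r. G (i # r # L xs)) (N xs))"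
proof -
  obtain f where f: "\<And>xs. length xs = k \<Longrightarrow> eval f xs = Some (F xs)"
    using F unfolding tot_def by blast
  obtain g where g: "\<And>xs. length xs = Suc (Suc k) \<Longrightarrow> eval g xs = Some (G xs)"
    using G unfolding tot_def by blast
  define H where "H zs = rec_nat (F (tl zs)) (\<lambda>i r. G (i # r # tl zs)) (hd zs)" for zs
  have "eval (PrimRec f g) (n # ys) = Some (H (n # ys))" if "length ys = k" for n ys
    unfolding H_def by (induction n) (use that f g in auto)
  then have "tot (Suc k) H"
    unfolding tot_def by (metis length_Suc_conv)
  from tot_comp[OF this tot_list_Cons[OF N L(1)]] show ?thesis
    using L(2) by (simp add: H_def)
qed

text \<open>A recursion of \<open>C xs\<close> rounds that starts with \<open>F\<close> and whose
  step forgets the previous value and returns \<open>G\<close>: no round leaves \<open>F\<close>,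
  any positive number of rounds gives \<open>G\<close>.\<close>

lemma tot_if:
  assumes "tot k C" "tot k F" "tot k G"
  shows "tot k (\<lambda>xs. if C xs = 0 then F xs else G xs)"
proof -
  have "tot (Suc (Suc k)) (\<lambda>zs. G (drop 2 zs))"
    by (rule tot_comp[OF assms(3) tot_list_drop]) simp
  from tot_rec[OF assms(2) this assms(1) tot_list_id]
  have "tot k (\<lambda>xs. rec_nat (F xs) (\<lambda>i r. G (drop 2 (i # r # xs))) (C xs))" by simp
  then show ?thesis
    by (rule tot_cong) (auto simp: gr0_conv_Suc)
qed

text \<open>The recursion step returns its counter, and in the last round this is
  \<open>F xs - 1\<close>; the starting value \<open>0\<close> agrees with truncated
  subtraction.\<close>

lemma tot_pred:
  assumes "tot k F"
  shows "tot k (\<lambda>xs. F xs - 1)"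
proof -
  have "tot k (\<lambda>xs. rec_nat 0 (\<lambda>i r. (i # r # []) ! 0) (F xs))"
    using tot_rec[OF tot_const tot_nth assms tot_list_Nil, of 0 0 0] by simp
  then show ?thesis
  proof (rule tot_cong)
    fix xs
    show "rec_nat 0 (\<lambda>i r. (i # r # []) ! 0) (F xs) = F xs - 1"
      by (cases "F xs") auto
  qed
qed

section \<open>Stage approximations\<close>

text \<open>Stage values are shifted by one: \<open>0\<close> means that no value has been found yet.\<close>

definition approx :: "(nat \<Rightarrow> nat) \<Rightarrow> nat option \<Rightarrow> bool" where
  "approx c v \<longleftrightarrow> (\<forall>s y. c s = Suc y \<longrightarrow> v = Some y) \<and>
     (v \<noteq> None \<longrightarrow> (\<forall>\<^sub>F s in sequentially. c s \<noteq> 0))"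

lemma approx_value: "approx c v \<Longrightarrow> c s \<noteq> 0 \<Longrightarrow> v = Some (c s - 1)"
  unfolding approx_def by (cases "c s") auto

lemma approx_eventually:
  "approx c (Some y) \<Longrightarrow> \<forall>\<^sub>F s in sequentially. c s = Suc y"
proof -
  assume a: "approx c (Some y)"
  then have "\<forall>\<^sub>F s in sequentially. c s \<noteq> 0" unfolding approx_def by blast
  then show ?thesis
  proof (rule eventually_mono)
    fix s assume "c s \<noteq> 0"
    with approx_value[OF a this] show "c s = Suc y" by simp
  qed
qed

lemma approxI:
  assumes "\<And>s. c s \<noteq> 0 \<Longrightarrow> v = Some (c s - 1)"
    and "\<And>y. v = Some y \<Longrightarrow> \<forall>\<^sub>F s in sequentially. c s = Suc y"
  shows "approx c v"
  unfolding approx_def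
proof (intro conjI allI impI)
  fix s y assume "c s = Suc y" then show "v = Some y" using assms(1)[of s] by simp
next
  assume "v \<noteq> None"
  then obtain y where "v = Some y" by blast
  from assms(2)[OF this] show "\<forall>\<^sub>F s in sequentially. c s \<noteq> 0"
    by (rule eventually_mono) simp
qed

lemma approx_undefined: "approx (\<lambda>s. 0) None"
  by (rule approxI) auto

lemma approx_defined: "approx (\<lambda>s. Suc y) (Some y)"
  by (rule approxI) auto

section \<open>Approximating composition, primitive recursion and minimization\<close>

text \<open>A nonzero stage value of an argument is already correct, so the outer approximation is
  only ever run on the true arguments. Being finitely many, the arguments have all settled from some
  stage on, and then the outer approximation settles on a fixed list.\<close>

lemma approx_Comp:
  assumes gs: "\<And>g. g \<in> set gs \<Longrightarrow> approx (\<lambda>s. c g s) (eval g xs)"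
    and f: "\<And>zs. length zs = length gs \<Longrightarrow> approx (\<lambda>s. d s zs) (eval f zs)"
  shows "approx (\<lambda>s. if \<exists>g\<in>set gs. c g s = 0 then 0 else d s (map (\<lambda>g. c g s - 1) gs))
     (eval (Comp f gs) xs)"
proof (rule approxI)
  fix s
  let ?zs = "map (\<lambda>g. c g s - 1) gs"
  let ?v = "if \<exists>g\<in>set gs. c g s = 0 then 0 else d s ?zs"
  assume "?v \<noteq> 0"
  then have nz: "\<forall>g\<in>set gs. c g s \<noteq> 0" "d s ?zs \<noteq> 0" by (auto split: if_splits)
  then have v: "?v = d s ?zs" by simp
  have g: "eval g xs = Some (c g s - 1)" if "g \<in> set gs" for g
    using approx_value[OF gs[OF that], of s] nz that by blast
  then have "eval (Comp f gs) xs = eval f (map (\<lambda>g. the (eval g xs)) gs)" by simp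
  also have "map (\<lambda>g. the (eval g xs)) gs = ?zs" using g by simp
  finally show "eval (Comp f gs) xs = Some (?v - 1)"
    unfolding v using approx_value[OF f[of ?zs], of s] nz by simp
next
  fix y
  assume y: "eval (Comp f gs) xs = Some y"
  let ?zs = "map (\<lambda>g. the (eval g xs)) gs"
  have def: "\<And>g. g \<in> set gs \<Longrightarrow> eval g xs = Some (the (eval g xs))"
    and fz: "eval f ?zs = Some y"
    using y by (auto split: if_splits)
  have "\<forall>g\<in>set gs. \<forall>\<^sub>F s in sequentially. c g s = Suc (the (eval g xs))"
    using approx_eventually gs def by metis
  then have 1: "\<forall>\<^sub>F s in sequentially. \<forall>g\<in>set gs. c g s = Suc (the (eval g xs))"
    by (intro eventually_ball_finite) auto
  have 2: "\<forall>\<^sub>F s in sequentially. d s ?zs = Suc y"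
    using approx_eventually f[of ?zs] fz by simp
  from 1 2 show "\<forall>\<^sub>F s in sequentially.
      (if \<exists>g\<in>set gs. c g s = 0 then 0 else d s (map (\<lambda>g. c g s - 1) gs)) = Suc y"
  proof eventually_elim
    case (elim s)
    then have "map (\<lambda>g. c g s - 1) gs = ?zs" by simp
    then have "d s (map (\<lambda>g. c g s - 1) gs) = Suc y" using elim(2) by (simp only:)
    moreover have "\<not> (\<exists>g\<in>set gs. c g s = 0)" using elim(1) by simp
    ultimately show ?case by (simp only: if_False)
  qed
qed

text \<open>Induction on the recursion argument: a previous value found at a stage is correct and
  eventually constant, so each further round approximates \<open>g\<close> at one fixed
  list.\<close>

lemma approx_PrimRec:
  assumes f: "approx (\<lambda>s. c s) (eval f ys)"
    and g: "\<And>m z. approx (\<lambda>s. d s (m # z # ys)) (eval g (m # z # ys))"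
  shows "approx (\<lambda>s. rec_nat (c s) (\<lambda>m r. if r = 0 then 0 else d s (m # (r - 1) # ys)) n)
     (eval (PrimRec f g) (n # ys))"
proof (induction n)
  case 0
  show ?case using f by simp
next
  case (Suc n)
  define q where "q s = rec_nat (c s) (\<lambda>m r. if r = 0 then 0 else d s (m # (r - 1) # ys)) n" for s
  define v where "v = eval (PrimRec f g) (n # ys)"
  have q: "approx q v" using Suc unfolding q_def v_def .
  have v: "eval (PrimRec f g) (Suc n # ys) =
      (case v of None \<Rightarrow> None | Some z \<Rightarrow> eval g (n # z # ys))"
    unfolding v_def by simp
  have "approx (\<lambda>s. if q s = 0 then 0 else d s (n # (q s - 1) # ys))
      (case v of None \<Rightarrow> None | Some z \<Rightarrow> eval g (n # z # ys))"
  proof (rule approxI)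
    fix s
    assume nz: "(if q s = 0 then 0 else d s (n # (q s - 1) # ys)) \<noteq> 0"
    then have "v = Some (q s - 1)" using approx_value[OF q] by (simp split: if_splits)
    then show "(case v of None \<Rightarrow> None | Some z \<Rightarrow> eval g (n # z # ys)) =
        Some ((if q s = 0 then 0 else d s (n # (q s - 1) # ys)) - 1)"
      using approx_value[OF g] nz by (simp split: if_splits)
  next
    fix y
    assume y: "(case v of None \<Rightarrow> None | Some z \<Rightarrow> eval g (n # z # ys)) = Some y"
    then obtain z where z: "v = Some z" "eval g (n # z # ys) = Some y"
      by (cases v) auto
    have "\<forall>\<^sub>F s in sequentially. q s = Suc z"
      using approx_eventually q z by simp
    moreover have "\<forall>\<^sub>F s in sequentially. d s (n # z # ys) = Suc y"
      using approx_eventually g z by metis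
    ultimately show "\<forall>\<^sub>F s in sequentially.
        (if q s = 0 then 0 else d s (n # (q s - 1) # ys)) = Suc y"
      by eventually_elim simp
  qed
  then show ?case unfolding v q_def by simp
qed

text \<open>The state is \<open>0\<close> while searching, \<open>1\<close> after meeting an undefined value,
  and \<open>n + 2\<close> once the zero \<open>n\<close> has been found.\<close>

definition search :: "(nat \<Rightarrow> nat) \<Rightarrow> nat \<Rightarrow> nat" where
  "search q n = rec_nat 0 (\<lambda>m r. if r = 0 then if q m = 0 then 1 else
     if q m - 1 = 0 then Suc (Suc m) else 0 else r) n"

lemma search_Suc: "search q (Suc m) =
   (if search q m = 0 then if q m = 0 then 1 else if q m - 1 = 0 then Suc (Suc m) else 0
    else search q m)"
  unfolding search_def by simp

text \<open>Because of the shift by one, \<open>q m > 1\<close> means that the value at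
  \<open>m\<close> is known and positive, the only case in which the search goes on.\<close>

lemma search_0_iff: "search q n = 0 \<longleftrightarrow> (\<forall>m<n. q m > 1)"
proof (induction n)
  case 0 then show ?case by (simp add: search_def)
next
  case (Suc n) then show ?case by (auto simp: search_Suc less_Suc_eq)
qed

text \<open>A nonzero state is frozen. Hence the first \<open>m\<close> with
  \<open>q m \<le> 1\<close> decides the outcome: a zero is found if \<open>q m = 1\<close>, and the
  search is stuck if \<open>q m = 0\<close>.\<close>

lemma search_found_iff:
  "search q n = Suc (Suc y) \<longleftrightarrow> y < n \<and> q y = 1 \<and> (\<forall>m<y. q m > 1)"
proof (induction n)
  case 0 then show ?case by (simp add: search_def)
next
  case (Suc n)
  show ?case
  proof (cases "search q n = 0")
    case True
    then have gt: "\<forall>m<n. q m > 1" using search_0_iff by blast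
    have "search q (Suc n) = Suc (Suc y) \<longleftrightarrow> y = n \<and> q n = 1"
      using True by (auto simp: search_Suc)
    moreover have "y < Suc n \<and> q y = 1 \<and> (\<forall>m<y. q m > 1) \<longleftrightarrow> y = n \<and> q n = 1"
      using gt by (metis less_Suc_eq less_irrefl)
    ultimately show ?thesis by (simp only:)
  next
    case False
    then have "\<not> (\<forall>m<n. q m > 1)" unfolding search_0_iff .
    then have "y < Suc n \<and> q y = 1 \<and> (\<forall>m<y. q m > 1) \<longleftrightarrow> y < n \<and> q y = 1 \<and> (\<forall>m<y. q m > 1)"
      by (cases "y = n") (blast, simp add: less_Suc_eq)
    moreover have "search q (Suc n) = search q n" using False by (simp add: search_Suc)
    ultimately show ?thesis using Suc by simp
  qed
qed

text \<open>The definedness condition in \<open>eval\<close> is stated for some zero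
  \<open>n\<close>, while the result is the least zero. The least zero is at most \<open>n\<close>,
  so definedness is inherited below it, and minimality makes the values there positive.\<close>

lemma eval_Mu_iff: "eval (Mu f) xs = Some y \<longleftrightarrow>
   eval f (y # xs) = Some 0 \<and> (\<forall>m<y. \<exists>z. eval f (m # xs) = Some (Suc z))"
proof
  assume L: "eval (Mu f) xs = Some y"
  then obtain n where n: "eval f (n # xs) = Some 0" "\<forall>m<n. eval f (m # xs) \<noteq> None"
    and y: "y = (LEAST n. eval f (n # xs) = Some 0)"
    by (auto split: if_splits)
  have "eval f (y # xs) = Some 0" unfolding y by (rule LeastI[of _ n]) (rule n)
  moreover have "y \<le> n" unfolding y by (rule Least_le) (rule n)
  moreover have "eval f (m # xs) \<noteq> Some 0" if "m < y" for m
    using not_less_Least that unfolding y by blast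
  ultimately show "eval f (y # xs) = Some 0 \<and> (\<forall>m<y. \<exists>z. eval f (m # xs) = Some (Suc z))"
    using n(2) by (metis (no_types) less_le_trans not0_implies_Suc option.exhaust)
next
  assume R: "eval f (y # xs) = Some 0 \<and> (\<forall>m<y. \<exists>z. eval f (m # xs) = Some (Suc z))"
  have "(LEAST n. eval f (n # xs) = Some 0) = y"
  proof (rule Least_equality)
    fix n assume "eval f (n # xs) = Some 0"
    then show "y \<le> n" using R by (metis Zero_not_Suc not_le option.inject)
  qed (use R in blast)
  moreover have "\<exists>n. eval f (n # xs) = Some 0 \<and> (\<forall>m<n. eval f (m # xs) \<noteq> None)"
    using R by (metis option.distinct(1))
  ultimately show "eval (Mu f) xs = Some y" by simp
qed

text \<open>The stage \<open>s\<close> bounds the search and is also the stage at which the body is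
  evaluated. Subtracting \<open>1\<close> merges the states "searching" and "stuck" into
  \<open>0\<close>, and turns the state \<open>y + 2\<close> into the shifted value
  \<open>y + 1\<close>. Convergence involves only the finitely many arguments up to
  \<open>y\<close>, once \<open>s\<close> exceeds \<open>y\<close>.\<close>

lemma approx_Mu:
  assumes f: "\<And>n. approx (\<lambda>s. c s (n # xs)) (eval f (n # xs))"
  shows "approx (\<lambda>s. search (\<lambda>n. c s (n # xs)) s - 1) (eval (Mu f) xs)"
proof (rule approxI)
  fix s
  let ?v = "search (\<lambda>n. c s (n # xs)) s - 1"
  assume "?v \<noteq> 0"
  then obtain y where y: "search (\<lambda>n. c s (n # xs)) s = Suc (Suc y)"
    by (cases "search (\<lambda>n. c s (n # xs)) s"; cases ?v) auto
  then have "c s (y # xs) = 1" "\<And>m. m < y \<Longrightarrow> c s (m # xs) > 1"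
    unfolding search_found_iff by auto
  then have "eval f (y # xs) = Some 0"
    "\<And>m. m < y \<Longrightarrow> eval f (m # xs) = Some (Suc (c s (m # xs) - 2))"
    using approx_value[OF f, of s]
    by (force, smt (verit) Suc_diff_Suc diff_Suc_1' not_less_zero numeral_2_eq_2 One_nat_def)
  then have "eval (Mu f) xs = Some y" unfolding eval_Mu_iff by blast
  then show "eval (Mu f) xs = Some (?v - 1)" using y by simp
next
  fix y
  assume "eval (Mu f) xs = Some y"
  then have y: "eval f (y # xs) = Some 0"
    and less: "\<And>m. m < y \<Longrightarrow> \<exists>z. eval f (m # xs) = Some (Suc z)"
    unfolding eval_Mu_iff by auto
  have "\<forall>\<^sub>F s in sequentially. c s (m # xs) > 1" if "m < y" for m
  proof -
    obtain z where "eval f (m # xs) = Some (Suc z)" using less \<open>m < y\<close> by blast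
    then have "\<forall>\<^sub>F s in sequentially. c s (m # xs) = Suc (Suc z)"
      using approx_eventually f by metis
    then show ?thesis by (rule eventually_mono) simp
  qed
  then have "\<forall>\<^sub>F s in sequentially. \<forall>m\<in>{..<y}. c s (m # xs) > 1"
    by (intro eventually_ball_finite) auto
  moreover have "\<forall>\<^sub>F s in sequentially. c s (y # xs) = Suc 0"
    using approx_eventually f y by metis
  moreover have "\<forall>\<^sub>F s in sequentially. y < s" by (rule eventually_gt_at_top)
  ultimately show "\<forall>\<^sub>F s in sequentially. search (\<lambda>n. c s (n # xs)) s - 1 = Suc y"
  proof eventually_elim
    case (elim s)
    then have "search (\<lambda>n. c s (n # xs)) s = Suc (Suc y)"
      unfolding search_found_iff by simp
    then show ?case by simp
  qed
qed

section \<open>Total stage functions for all programs\<close>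

text \<open>The stage is made the first argument of a single total computable function, uniformly in
  the remaining \<open>k\<close> arguments.\<close>

definition staged :: "nat \<Rightarrow> recf \<Rightarrow> (nat \<Rightarrow> nat list \<Rightarrow> nat) \<Rightarrow> bool" where
  "staged k f T \<longleftrightarrow> tot (Suc k) (\<lambda>zs. T (zs ! 0) (drop 1 zs)) \<and>
     (\<forall>xs. length xs = k \<longrightarrow> approx (\<lambda>s. T s xs) (eval f xs))"

lemma stagedD:
  assumes "staged k f T"
  shows "tot (Suc k) (\<lambda>zs. T (zs ! 0) (drop 1 zs))"
    and "length xs = k \<Longrightarrow> approx (\<lambda>s. T s xs) (eval f xs)"
  using assms unfolding staged_def by auto

lemma staged_tot:
  assumes "staged k f T" "tot m S" "tot_list m L" "\<And>zs. length zs = m \<Longrightarrow> length (L zs) = k"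
  shows "tot m (\<lambda>zs. T (S zs) (L zs))"
  using tot_comp[OF stagedD(1)[OF assms(1)] tot_list_Cons[OF assms(2,3)]] assms(4) by simp

lemma tot_guard:
  assumes "\<And>g. g \<in> set gs \<Longrightarrow> tot k (C g)" "tot k F"
  shows "tot k (\<lambda>xs. if \<exists>g\<in>set gs. C g xs = 0 then 0 else F xs)"
  using assms(1)
proof (induction gs)
  case Nil
  show ?case using assms(2) by simp
next
  case (Cons g gs)
  have "tot k (\<lambda>xs. if C g xs = 0 then 0 else if \<exists>g\<in>set gs. C g xs = 0 then 0 else F xs)"
    using Cons by (intro tot_if tot_const) auto
  then show ?case by (rule tot_cong) auto
qed

text \<open>Induction over programs, with \<open>k\<close> arbitrary because subprograms receive
  lists of other lengths. On lists of unsuitable length the program diverges, and the constant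
  \<open>0\<close> approximates that.\<close>

lemma ex_staged: "\<exists>T. staged k f T"
proof (induction f arbitrary: k)
  case Zero
  have "staged k Zero (\<lambda>s xs. Suc 0)"
    unfolding staged_def using tot_const approx_defined by simp
  then show ?case by blast
next
  case Succ
  show ?case
  proof (cases "k = 1")
    case True
    have "tot 2 (\<lambda>zs. Suc (Suc (zs ! 1)))" by (intro tot_Suc tot_nth) simp
    then have "tot 2 (\<lambda>zs. Suc (Suc (drop 1 zs ! 0)))" by (rule tot_cong) simp
    then have "staged 1 Succ (\<lambda>s xs. Suc (Suc (xs ! 0)))"
      unfolding staged_def
      by (auto simp: length_Suc_conv numeral_2_eq_2 approx_defined)
    then show ?thesis using True by blast
  next
    case False
    then have "staged k Succ (\<lambda>s xs. 0)"
      unfolding staged_def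
      by (auto simp: tot_const approx_undefined split: list.split)
    then show ?thesis by blast
  qed
next
  case (Proj i)
  show ?case
  proof (cases "i < k")
    case True
    have "tot (Suc k) (\<lambda>zs. Suc (zs ! Suc i))"
      using True by (intro tot_Suc tot_nth) simp
    then have "tot (Suc k) (\<lambda>zs. Suc (drop 1 zs ! i))" by (rule tot_cong) simp
    then have "staged k (Proj i) (\<lambda>s xs. Suc (xs ! i))"
      unfolding staged_def using True by (auto simp: approx_defined)
    then show ?thesis by blast
  next
    case False
    then have "staged k (Proj i) (\<lambda>s xs. 0)"
      unfolding staged_def by (auto simp: tot_const approx_undefined)
    then show ?thesis by blast
  qed
next
  case (Comp f gs)
  obtain D where D: "staged (length gs) f D" using Comp.IH(1) by blast
  have "\<forall>g\<in>set gs. \<exists>T. staged k g T" using Comp.IH(2) by blast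
  then obtain C where C: "\<And>g. g \<in> set gs \<Longrightarrow> staged k g (C g)" by metis
  let ?T = "\<lambda>s xs. if \<exists>g\<in>set gs. C g s xs = 0 then 0
    else D s (map (\<lambda>g. C g s xs - 1) gs)"
  have "tot (Suc k) (\<lambda>zs. D (zs ! 0) (map (\<lambda>g. C g (zs ! 0) (drop 1 zs) - 1) gs))"
    by (rule staged_tot[OF D tot_nth tot_list_map]) (simp, rule tot_pred, rule stagedD(1)[OF C], simp_all)
  then have "tot (Suc k) (\<lambda>zs. ?T (zs ! 0) (drop 1 zs))"
    by (rule tot_guard[where C = "\<lambda>g zs. C g (zs ! 0) (drop 1 zs)", rotated])
      (rule stagedD(1), erule C)
  moreover have "approx (\<lambda>s. ?T s xs) (eval (Comp f gs) xs)" if "length xs = k" for xs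
    by (rule approx_Comp) (use stagedD(2) C D that in blast)+
  ultimately have "staged k (Comp f gs) ?T" unfolding staged_def by blast
  then show ?case by blast
next
  case (PrimRec f g)
  show ?case
  proof (cases k)
    case 0
    then have "staged k (PrimRec f g) (\<lambda>s xs. 0)"
      unfolding staged_def by (auto simp: tot_const approx_undefined)
    then show ?thesis by blast
  next
    case (Suc l)
    obtain C where C: "staged l f C" using PrimRec.IH(1) by blast
    obtain D where D: "staged (Suc (Suc l)) g D" using PrimRec.IH(2) by blast
    let ?T = "\<lambda>s xs. rec_nat (C s (drop 1 xs))
      (\<lambda>m r. if r = 0 then 0 else D s (m # (r - 1) # drop 1 xs)) (xs ! 0)"
    \<comment> \<open>In the recursion step, \<open>zs\<close> consists of the counter, the previous
      shifted value, the stage, and then the parameters.\<close>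
    have "tot (Suc (Suc (Suc l)))
        (\<lambda>zs. D (zs ! 2) (zs ! 0 # (zs ! 1 - 1) # drop 3 zs))"
      by (rule staged_tot[OF D]) ((intro tot_nth tot_list_Cons tot_list_drop tot_pred; simp)+, simp)
    then have G: "tot (Suc (Suc (Suc l)))
        (\<lambda>zs. if zs ! 1 = 0 then 0 else D (zs ! 2) (zs ! 0 # (zs ! 1 - 1) # drop 3 zs))"
      by (intro tot_if tot_const tot_nth) auto
    \<comment> \<open>Here \<open>zs\<close> is the stage, the recursion argument and the
      parameters; the recursion argument is dropped since it becomes the number of rounds.\<close>
    have "tot_list (Suc (Suc l)) (\<lambda>zs. zs ! 0 # drop 2 zs)"
      by (intro tot_list_Cons tot_nth tot_list_drop) simp
    from tot_rec[OF stagedD(1)[OF C] G tot_nth this, of 1]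
    have "tot (Suc (Suc l)) (\<lambda>zs. rec_nat (C (zs ! 0) (drop 2 zs))
        (\<lambda>m r. if r = 0 then 0 else D (zs ! 0) (m # (r - 1) # drop 2 zs)) (zs ! 1))"
      by (simp add: numeral_2_eq_2 numeral_3_eq_3 cong: if_cong)
    then have "tot (Suc (Suc l)) (\<lambda>zs. ?T (zs ! 0) (drop 1 zs))"
      by (rule tot_cong) (simp add: numeral_2_eq_2 cong: if_cong)
    moreover have "approx (\<lambda>s. ?T s xs) (eval (PrimRec f g) xs)" if "length xs = Suc l" for xs
    proof -
      obtain n ys where xs: "xs = n # ys" "length ys = l"
        using \<open>length xs = Suc l\<close> by (auto simp: length_Suc_conv)
      have "approx (\<lambda>s. C s ys) (eval f ys)"
        "\<And>m z. approx (\<lambda>s. D s (m # z # ys)) (eval g (m # z # ys))"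
        using stagedD(2)[OF C] stagedD(2)[OF D] xs by auto
      from approx_PrimRec[OF this, of n] show ?thesis using xs by (simp cong: if_cong)
    qed
    ultimately have "staged k (PrimRec f g) ?T" unfolding staged_def Suc by blast
    then show ?thesis by blast
  qed
next
  case (Mu f)
  obtain C where C: "staged (Suc k) f C" using Mu.IH by blast
  let ?T = "\<lambda>s xs. search (\<lambda>n. C s (n # xs)) s - 1"
  \<comment> \<open>The list \<open>zs\<close> holds the candidate, the search state, the stage, and
    then the arguments of the minimization.\<close>
  let ?C = "\<lambda>zs. C (zs ! 2) (zs ! 0 # drop 3 zs)"
  have c: "tot (Suc (Suc (Suc k))) ?C"
    by (rule staged_tot[OF C]) ((intro tot_nth tot_list_Cons tot_list_drop; simp)+, simp)
  have G: "tot (Suc (Suc (Suc k)))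
      (\<lambda>zs. if zs ! 1 = 0 then if ?C zs = 0 then 1 else if ?C zs - 1 = 0
         then Suc (Suc (zs ! 0)) else 0 else zs ! 1)"
    by (intro tot_if tot_const tot_Suc tot_nth tot_pred c) auto
  have "tot (Suc k) (\<lambda>zs. search (\<lambda>n. C (zs ! 0) (n # drop 1 zs)) (zs ! 0))"
    unfolding search_def
    by (rule tot_cong[OF tot_rec[OF tot_const G tot_nth tot_list_id, of 0]])
      (simp_all add: numeral_2_eq_2 numeral_3_eq_3 cong: if_cong)
  then have "tot (Suc k) (\<lambda>zs. ?T (zs ! 0) (drop 1 zs))" by (rule tot_pred)
  moreover have "approx (\<lambda>s. ?T s xs) (eval (Mu f) xs)" if "length xs = k" for xs
    by (rule approx_Mu) (use stagedD(2)[OF C] that in simp)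
  ultimately have "staged k (Mu f) ?T" unfolding staged_def by blast
  then show ?case by blast
qed

section \<open>Computable and c.e. sets\<close>

lemma computable_iff_tot: "computable S \<longleftrightarrow> tot 1 (\<lambda>xs. if xs ! 0 \<in> S then 1 else 0)"
proof -
  have "(\<forall>x. eval p [x] = Some (if x \<in> S then 1 else 0)) \<longleftrightarrow>
    (\<forall>xs. length xs = 1 \<longrightarrow> eval p xs = Some (if xs ! 0 \<in> S then 1 else 0))" for p
    by (auto simp: length_Suc_conv)
  then show ?thesis unfolding computable_def tot_def by simp
qed

text \<open>A projection normal form, with \<open>0\<close> as truth value. From left to right the
  witness \<open>s\<close> is a stage at which the program has produced a value; from right to left
  \<open>Mu\<close> searches for \<open>s\<close>, and totality of \<open>F\<close> keeps this
  search from getting stuck.\<close>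

lemma ce_tot_iff: "ce S \<longleftrightarrow> (\<exists>F. tot 2 F \<and> S = {x. \<exists>s. F [s, x] = 0})"
proof
  assume "ce S"
  then obtain f where S: "S = {x. eval f [x] \<noteq> None}" unfolding ce_def by blast
  obtain T where T: "staged 1 f T" using ex_staged by blast
  let ?F = "\<lambda>zs. if T (zs ! 0) (drop 1 zs) = 0 then Suc 0 else 0"
  have "tot 2 ?F"
    using tot_if[OF stagedD(1)[OF T] tot_const tot_const] by (simp add: numeral_2_eq_2)
  moreover have "(\<exists>s. ?F [s, x] = 0) \<longleftrightarrow> eval f [x] \<noteq> None" for x
  proof -
    have a: "approx (\<lambda>s. T s [x]) (eval f [x])" using stagedD(2)[OF T] by simp
    have "eval f [x] \<noteq> None" if "T s [x] \<noteq> 0" for s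
      using approx_value[OF a, of s] that by simp
    moreover have "\<exists>s. T s [x] \<noteq> 0" if "eval f [x] \<noteq> None"
    proof -
      have "\<forall>\<^sub>F s in sequentially. T s [x] \<noteq> 0" using a that unfolding approx_def by blast
      then show ?thesis by (rule eventually_happens'[OF sequentially_bot])
    qed
    ultimately have "(\<exists>s. T s [x] \<noteq> 0) \<longleftrightarrow> eval f [x] \<noteq> None" by blast
    then show ?thesis by simp
  qed
  ultimately show "\<exists>F. tot 2 F \<and> S = {x. \<exists>s. F [s, x] = 0}"
    unfolding S by (intro exI[of _ ?F]) simp
next
  assume "\<exists>F. tot 2 F \<and> S = {x. \<exists>s. F [s, x] = 0}"
  then obtain F p where S: "S = {x. \<exists>s. F [s, x] = 0}"
    and "\<And>zs. length zs = 2 \<Longrightarrow> eval p zs = Some (F zs)"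
    unfolding tot_def by blast
  then have "eval p [s, x] = Some (F [s, x])" for s x by simp
  then have "S = {x. eval (Mu p) [x] \<noteq> None}" unfolding S by simp
  then show "ce S" unfolding ce_def by blast
qed

text \<open>In projection form, the disjunction of the two total tests at a common \<open>s\<close>
  replaces running two possibly divergent computations in parallel.\<close>

lemma ce_Un:
  assumes "ce S" "ce T"
  shows "ce (S \<union> T)"
proof -
  obtain F where F: "tot 2 F" "S = {x. \<exists>s. F [s, x] = 0}" using assms(1) unfolding ce_tot_iff by blast
  obtain G where G: "tot 2 G" "T = {x. \<exists>s. G [s, x] = 0}" using assms(2) unfolding ce_tot_iff by blast
  have "tot 2 (\<lambda>zs. if F zs = 0 then 0 else G zs)" by (intro tot_if tot_const F G)
  moreover have "(if F zs = 0 then 0 else G zs) = 0 \<longleftrightarrow> F zs = 0 \<or> G zs = 0" for zs by simp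
  then have "S \<union> T = {x. \<exists>s. (if F [s, x] = 0 then 0 else G [s, x]) = 0}"
    unfolding F G by blast
  ultimately show ?thesis
    unfolding ce_tot_iff by (intro exI[of _ "\<lambda>zs. if F zs = 0 then 0 else G zs"]) simp
qed

lemma ce_Int:
  assumes "ce S" "ce T"
  shows "ce (S \<inter> T)"
proof -
  obtain f g where "S = {x. eval f [x] \<noteq> None}" "T = {x. eval g [x] \<noteq> None}"
    using assms unfolding ce_def by blast
  \<comment> \<open>\<open>Comp\<close> diverges as soon as one argument does, and
    \<open>Zero\<close> discards the values.\<close>
  then have "S \<inter> T = {x. eval (Comp Zero [f, g]) [x] \<noteq> None}" by auto
  then show ?thesis unfolding ce_def by blast
qed

lemma computable_imp_ce:
  assumes "computable S"
  shows "ce S"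
proof -
  have "tot 2 (\<lambda>zs. if (drop 1 zs) ! 0 \<in> S then 1 else 0)"
    using tot_comp[OF assms[unfolded computable_iff_tot] tot_list_drop] by simp
  then have "tot 2 (\<lambda>zs. if (if (drop 1 zs) ! 0 \<in> S then 1 else 0) = (0::nat) then 1 else 0)"
    by (intro tot_if tot_const)
  moreover have "S = {x. \<exists>s::nat. (if (if (drop 1 [s, x]) ! 0 \<in> S then 1 else 0) = (0::nat) then 1 else 0) = (0::nat)}"
    by simp
  ultimately show ?thesis unfolding ce_tot_iff by blast
qed

section \<open>Boolean closure of the computable sets\<close>

text \<open>Complement and union are both obtained as instances of this case distinction.\<close>

lemma computable_if:
  assumes "computable S" "computable T" "computable U"
  shows "computable {x. if x \<in> S then x \<in> T else x \<in> U}"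
proof -
  have "tot 1 (\<lambda>xs. if (if xs ! 0 \<in> S then 1 else 0) = (0::nat)
    then (if xs ! 0 \<in> U then 1 else 0) else (if xs ! 0 \<in> T then 1 else 0))"
    by (intro tot_if assms[unfolded computable_iff_tot])
  then show ?thesis unfolding computable_iff_tot by (rule tot_cong) auto
qed

lemma computable_empty: "computable {}"
  unfolding computable_iff_tot using tot_const by simp

lemma computable_Compl: "computable S \<Longrightarrow> computable (- S)"
proof -
  have "computable UNIV" unfolding computable_iff_tot using tot_const by simp
  moreover assume "computable S"
  ultimately have "computable {x. if x \<in> S then x \<in> {} else x \<in> UNIV}"
    by (intro computable_if computable_empty)
  moreover have "{x. if x \<in> S then x \<in> {} else x \<in> UNIV} = - S" by auto
  ultimately show ?thesis by simp
qed

lemma computable_Un: "computable S \<Longrightarrow> computable T \<Longrightarrow> computable (S \<union> T)"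
proof -
  assume "computable S" "computable T"
  then have "computable {x. if x \<in> S then x \<in> S else x \<in> T}" by (intro computable_if)
  moreover have "{x. if x \<in> S then x \<in> S else x \<in> T} = S \<union> T" by auto
  ultimately show ?thesis by simp
qed

lemma computable_Diff: "computable S \<Longrightarrow> computable T \<Longrightarrow> computable (S - T)"
  using computable_Compl[OF computable_Un[OF computable_Compl, of S T]]
  by (simp add: Diff_eq)

lemma computable_UN:
  "finite N \<Longrightarrow> (\<And>n. n \<in> N \<Longrightarrow> computable (E n)) \<Longrightarrow> computable (\<Union>n\<in>N. E n)"
  by (induction N rule: finite_induct) (auto intro: computable_empty computable_Un)

text \<open>Induction on \<open>a\<close>: a number equals \<open>Suc a\<close> iff it is nonzero
  and its predecessor is \<open>a\<close>.\<close>

lemma computable_singleton: "computable {a}"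
proof (induction a)
  case 0
  have "tot 1 (\<lambda>xs. if xs ! 0 = 0 then 1 else 0)" by (intro tot_if tot_const tot_nth) simp
  then show ?case unfolding computable_iff_tot by simp
next
  case (Suc a)
  have "tot 1 (\<lambda>xs. if [xs ! 0 - 1] ! 0 \<in> {a} then 1 else 0)"
    by (rule tot_comp[OF Suc[unfolded computable_iff_tot]])
      (auto intro!: tot_list_Cons tot_list_Nil tot_pred[simplified] tot_nth)
  then have "tot 1 (\<lambda>xs. if xs ! 0 = 0 then 0 else if [xs ! 0 - 1] ! 0 \<in> {a} then 1 else 0)"
    by (intro tot_if tot_const tot_nth) auto
  then show ?case unfolding computable_iff_tot by (rule tot_cong) auto
qed

lemma computable_finite: "finite S \<Longrightarrow> computable S"
  using computable_UN[of S "\<lambda>x. {x}"] computable_singleton by simp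

lemma ce_Diff_computable: "ce S \<Longrightarrow> computable C \<Longrightarrow> ce (S - C)"
  by (simp add: Diff_eq ce_Int computable_imp_ce computable_Compl)

lemma ce_UN:
  "finite N \<Longrightarrow> (\<And>n. n \<in> N \<Longrightarrow> ce (E n)) \<Longrightarrow> ce (\<Union>n\<in>N. E n)"
  by (induction N rule: finite_induct)
    (auto intro: ce_Un computable_imp_ce[OF computable_empty])

instance recf :: countable
  by countable_datatype

text \<open>There are only countably many programs. The enumerations drawn from this are
  set-theoretic, not effective.\<close>

lemma countable_ce: "countable {S. ce S}"
proof -
  have "{S. ce S} = range (\<lambda>f. {x. eval f [x] \<noteq> None})" unfolding ce_def by blast
  then show ?thesis by simp
qed

section \<open>Sets disjoint from a given set\<close>

text \<open>These are the sets that a generating collection must almost cover, and also the sets it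
  is drawn from.\<close>

definition disj_ce :: "nat set \<Rightarrow> nat set set" where
  "disj_ce A = {D. ce D \<and> D \<inter> A = {}}"

lemma disj_ce_Un: "D \<in> disj_ce A \<Longrightarrow> D' \<in> disj_ce A \<Longrightarrow> D \<union> D' \<in> disj_ce A"
  unfolding disj_ce_def by (auto intro: ce_Un)

lemma disj_ce_UN:
  "finite N \<Longrightarrow> (\<And>n. n \<in> N \<Longrightarrow> E n \<in> disj_ce A) \<Longrightarrow> (\<Union>n\<in>N. E n) \<in> disj_ce A"
  unfolding disj_ce_def by (auto intro: ce_UN)

lemma ex_disj_ce_enum: "\<exists>U :: nat \<Rightarrow> nat set. range U = disj_ce A"
proof -
  have "{} \<in> disj_ce A"
    unfolding disj_ce_def using computable_imp_ce[OF computable_empty] by simp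
  moreover have "countable (disj_ce A)"
    by (rule countable_subset[OF _ countable_ce]) (auto simp: disj_ce_def)
  ultimately have "range (from_nat_into (disj_ce A)) = disj_ce A"
    by (intro range_from_nat_into) auto
  then show ?thesis by blast
qed

lemma almost_subset_mono: "D \<subseteq>\<^sup>* X \<Longrightarrow> X \<subseteq> Y \<Longrightarrow> D \<subseteq>\<^sup>* Y"
  unfolding almost_subset_def by (erule rev_finite_subset) auto

lemma subset_imp_almost_subset: "D \<subseteq> X \<Longrightarrow> D \<subseteq>\<^sup>* X"
  unfolding almost_subset_def by (simp add: Diff_eq_empty_iff[THEN iffD2])

lemma generates_DI:
  assumes "G \<subseteq> disj_ce A"
    and "\<And>D. D \<in> disj_ce A \<Longrightarrow> \<exists>F. F \<subseteq> G \<and> finite F \<and> D \<subseteq>\<^sup>* \<Union>F"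
  shows "generates_D G A"
  using assms unfolding generates_D_def disj_ce_def by blast

section \<open>The case without good supersets: type 10\<close>

text \<open>No superset of \<open>W\<close> in \<open>disj_ce A\<close> is good, so a chain that
  starts above \<open>W\<close> can be continued forever with differences that are not c.e., while
  absorbing an enumeration of \<open>disj_ce A\<close>.\<close>

lemma type10_if_no_splitting:
  assumes W: "W \<in> disj_ce A"
    and split: "\<And>D. D \<in> disj_ce A \<Longrightarrow> W \<subseteq> D \<Longrightarrow> \<exists>D'\<in>disj_ce A. \<not> ce (D' - D)"
  shows "\<exists>G. generates_D G A \<and> type10 G"
proof -
  obtain U :: "nat \<Rightarrow> nat set" where U: "range U = disj_ce A" using ex_disj_ce_enum[of A] ..
  have "\<exists>f. \<forall>n. (f n \<in> disj_ce A \<and> W \<subseteq> f n) \<and>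
      (f n \<subseteq> f (Suc n) \<and> U n \<subseteq> f (Suc n) \<and> \<not> ce (f (Suc n) - f n))"
  proof (rule dependent_nat_choice)
    show "\<exists>D. D \<in> disj_ce A \<and> W \<subseteq> D" using W by blast
  next
    fix D n
    assume D: "D \<in> disj_ce A \<and> W \<subseteq> D"
    then obtain D' where D': "D' \<in> disj_ce A" "\<not> ce (D' - D)" using split by blast
    \<comment> \<open>\<open>D\<close> keeps the chain increasing, \<open>U n\<close> makes it
      cofinal, and \<open>D'\<close> spoils the difference.\<close>
    let ?V = "D \<union> U n \<union> D'"
    \<comment> \<open>Were \<open>?V - D\<close> c.e., its intersection with the c.e. set
      \<open>D'\<close> would be c.e. as well.\<close>
    have "D' - D = (?V - D) \<inter> D'" by blast
    then have "\<not> ce (?V - D)" using D' ce_Int unfolding disj_ce_def by auto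
    moreover have "U n \<in> disj_ce A" using U by blast
    then have "?V \<in> disj_ce A" using D D'(1) by (intro disj_ce_Un) auto
    ultimately show "\<exists>V. (V \<in> disj_ce A \<and> W \<subseteq> V) \<and> D \<subseteq> V \<and> U n \<subseteq> V \<and> \<not> ce (V - D)"
      using D by (intro exI[of _ ?V]) auto
  qed
  then obtain f where f: "\<And>n. f n \<in> disj_ce A" "\<And>n. W \<subseteq> f n" "\<And>n. f n \<subseteq> f (Suc n)"
    "\<And>n. U n \<subseteq> f (Suc n)" "\<And>n. \<not> ce (f (Suc n) - f n)"
    by blast
  \<comment> \<open>A computable \<open>f n\<close> would be good, since subtracting a computable
    set preserves being c.e.\<close>
  have nc: "\<not> computable (f n)" for n
  proof
    assume c: "computable (f n)"
    obtain D' where "D' \<in> disj_ce A" "\<not> ce (D' - f n)" using split[OF f(1,2)[of n]] by blast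
    then show False using ce_Diff_computable[OF _ c] by (simp add: disj_ce_def)
  qed
  then have "infinite (f n)" for n using computable_finite by blast
  then have "type10 (range f)"
    unfolding type10_def by (intro exI[of _ f] conjI allI refl f nc)
  moreover have "generates_D (range f) A"
  proof (rule generates_DI)
    fix D assume "D \<in> disj_ce A"
    then obtain n where "D = U n" using U by blast
    then have "D \<subseteq>\<^sup>* \<Union>{f (Suc n)}" using f(4) by (intro subset_imp_almost_subset) simp
    then show "\<exists>F. F \<subseteq> range f \<and> finite F \<and> D \<subseteq>\<^sup>* \<Union>F"
      by (intro exI[of _ "{f (Suc n)}"]) simp
  qed (use f in blast)
  ultimately show ?thesis by blast
qed

section \<open>Grouping a sequence into finite blocks\<close>

definition block :: "(nat \<Rightarrow> 'a set) \<Rightarrow> (nat \<Rightarrow> nat) \<Rightarrow> nat \<Rightarrow> 'a set" where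
  "block E h i = (\<Union>n\<in>{h i..<h (Suc i)}. E n)"

lemma UN_block:
  assumes "mono h" "h 0 = 0"
  shows "(\<Union>i<n. block E h i) = (\<Union>j<h n. E j)"
proof (induction n)
  case (Suc n)
  have "{..<h (Suc n)} = {..<h n} \<union> {h n..<h (Suc n)}"
    using monoD[OF assms(1), of n "Suc n"] by auto
  then show ?case using Suc by (simp add: lessThan_Suc block_def) blast
qed (simp add: assms)

lemma disjoint_family_block:
  assumes "disjoint_family E" "mono h"
  shows "disjoint_family (block E h)"
proof -
  have less: "block E h i \<inter> block E h j = {}" if "i < j" for i j
  proof -
    have "h (Suc i) \<le> h j" using that assms(2) by (simp add: monoD)
    then have "E m \<inter> E n = {}" if "m \<in> {h i..<h (Suc i)}" "n \<in> {h j..<h (Suc j)}" for m n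
      using that disjoint_family_onD[OF assms(1), of m n] by simp
    then show ?thesis
      unfolding block_def by (simp add: Int_UN_distrib2)
  qed
  have "i \<noteq> j \<Longrightarrow> block E h i \<inter> block E h j = {}" for i j
    using less[of i j] less[of j i] by (cases i j rule: linorder_cases) (simp_all add: Int_commute)
  then show ?thesis unfolding disjoint_family_on_def by simp
qed

text \<open>Cutting the indices behind each element of \<open>S\<close> puts exactly one element of \<open>S\<close>
  into each block.\<close>

lemma ex_block_boundaries:
  fixes S :: "nat set"
  assumes "infinite S"
  obtains h where "mono h" "h 0 = 0" "\<And>n. n \<le> h n" "\<And>i. \<exists>s. {h i..<h (Suc i)} \<inter> S = {s}"
proof
  define h where "h i = (case i of 0 \<Rightarrow> 0 | Suc j \<Rightarrow> Suc (enumerate S j))" for i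
  have hS: "\<And>i. h (Suc i) = Suc (enumerate S i)" by (simp_all add: h_def)
  have le: "h i \<le> enumerate S i" for i
    using enumerate_step[OF assms] by (cases i) (auto simp: h_def Suc_le_eq)
  show "mono h" unfolding mono_iff_le_Suc using le hS by (metis le_SucI)
  show "h 0 = 0" by (simp add: h_def)
  show "n \<le> h n" for n
    using le_enumerate[OF assms] by (cases n) (auto simp: h_def)
  have "{h i..<h (Suc i)} \<inter> S = {enumerate S i}" for i
  proof -
    have "s = enumerate S i" if s: "s \<in> S" "h i \<le> s" "s < h (Suc i)" for s
    proof -
      obtain j where j: "s = enumerate S j" using enumerate_Ex[OF _ s(1)] assms by metis
      have "j \<le> i" using s(3) j hS[of i] assms by (simp add: less_Suc_eq_le)
      moreover have "\<not> j < i"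
      proof
        assume "j < i"
        then obtain k where "i = Suc k" "j \<le> k" by (cases i) auto
        then show False using s(2) j hS[of k] assms by (simp add: Suc_le_eq)
      qed
      ultimately show ?thesis using j by simp
    qed
    then show ?thesis using le hS enumerate_in_set[OF assms] by auto
  qed
  then show "\<exists>s. {h i..<h (Suc i)} \<inter> S = {s}" for i by blast
qed

lemma computable_block:
  "(\<And>n. computable (E n)) \<Longrightarrow> computable (block E h i)"
  unfolding block_def by (rule computable_UN) auto

lemma disj_ce_block:
  "(\<And>n. E n \<in> disj_ce A) \<Longrightarrow> block E h i \<in> disj_ce A"
  unfolding block_def by (rule disj_ce_UN) auto

text \<open>All members of the block other than \<open>E s\<close> are computable. If the block were
  computable, removing their union would leave exactly \<open>E s\<close>, by disjointness, and
  \<open>E s\<close> would be computable.\<close>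

lemma noncomputable_block:
  assumes "disjoint_family E" "{h i..<h (Suc i)} \<inter> {n. \<not> computable (E n)} = {s}"
  shows "\<not> computable (block E h i)"
proof
  assume c: "computable (block E h i)"
  let ?R = "\<Union>n\<in>{h i..<h (Suc i)} - {s}. E n"
  have s: "s \<in> {h i..<h (Suc i)} \<inter> {n. \<not> computable (E n)}" unfolding assms(2) by simp
  have "computable ?R"
  proof (rule computable_UN)
    fix n assume n: "n \<in> {h i..<h (Suc i)} - {s}"
    then have "n \<notin> {h i..<h (Suc i)} \<inter> {n. \<not> computable (E n)}" unfolding assms(2) by simp
    with n show "computable (E n)" by simp
  qed simp
  moreover have "E s \<inter> ?R = {}"
    using disjoint_family_onD[OF assms(1), of s] by (simp add: Int_UN_distrib)
  moreover have "s \<in> {h i..<h (Suc i)}" using s by simp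
  then have "block E h i = E s \<union> ?R" unfolding block_def by blast
  ultimately have "block E h i - ?R = E s" by blast
  with computable_Diff[OF c \<open>computable ?R\<close>] have "computable (E s)" by simp
  then show False using s by simp
qed

lemma infinite_block:
  assumes "{h i..<h (Suc i)} \<inter> {n. infinite (E n)} = {s}"
  shows "infinite (block E h i)"
proof -
  have s: "s \<in> {h i..<h (Suc i)} \<inter> {n. infinite (E n)}" unfolding assms by simp
  then have "E s \<subseteq> block E h i" unfolding block_def by (intro UN_upper) simp
  then show ?thesis using s finite_subset by auto
qed

section \<open>Generating sequences and types 1 to 6\<close>

text \<open>Initial segments take the place of finite subcollections. Unlike \<open>range E\<close>,
  the sequence keeps its indices and can be regrouped into blocks.\<close>

definition seq_generates :: "(nat \<Rightarrow> nat set) \<Rightarrow> nat set \<Rightarrow> bool" where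
  "seq_generates E A \<longleftrightarrow> (\<forall>n. E n \<in> disj_ce A) \<and>
     (\<forall>D\<in>disj_ce A. \<exists>n. D \<subseteq>\<^sup>* (\<Union>i<n. E i))"

lemma seq_generatesD:
  assumes "seq_generates E A"
  shows "generates_D (range E) A"
proof (rule generates_DI)
  fix D assume "D \<in> disj_ce A"
  then obtain n where "D \<subseteq>\<^sup>* (\<Union>i<n. E i)" using assms unfolding seq_generates_def by blast
  then show "\<exists>F. F \<subseteq> range E \<and> finite F \<and> D \<subseteq>\<^sup>* \<Union>F"
    by (intro exI[of _ "E ` {..<n}"]) auto
qed (use assms seq_generates_def in blast)

text \<open>The first \<open>n\<close> blocks make up the first \<open>h n\<close> members, and
  \<open>n \<le> h n\<close> ensures that these include the first \<open>n\<close>.\<close>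

lemma seq_generates_block:
  assumes E: "seq_generates E A" and h: "mono h" "h 0 = 0" "\<And>n. n \<le> h n"
  shows "seq_generates (block E h) A"
  unfolding seq_generates_def
proof (intro conjI ballI allI)
  show "block E h n \<in> disj_ce A" for n
    by (rule disj_ce_block) (use E seq_generates_def in blast)
next
  fix D assume "D \<in> disj_ce A"
  then obtain n where "D \<subseteq>\<^sup>* (\<Union>i<n. E i)" using E unfolding seq_generates_def by blast
  moreover have "(\<Union>i<n. E i) \<subseteq> (\<Union>i<h n. E i)"
    using h(3)[of n] by (intro UN_mono) auto
  ultimately show "\<exists>n. D \<subseteq>\<^sup>* (\<Union>i<n. block E h i)"
    unfolding UN_block[OF h(1,2)] using almost_subset_mono by blast
qed

text \<open>Blocks with exactly one noncomputable member swallow the computable members and stay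
  noncomputable. They are then infinite, as finite sets are computable.\<close>

lemma type6_of_disjoint_seq:
  assumes E: "seq_generates E A" "disjoint_family E" and inf: "infinite {n. \<not> computable (E n)}"
  shows "\<exists>G. generates_D G A \<and> type6 G"
proof -
  obtain h where h: "mono h" "h 0 = 0" "\<And>n. n \<le> h n"
    "\<And>i. \<exists>s. {h i..<h (Suc i)} \<inter> {n. \<not> computable (E n)} = {s}"
    using ex_block_boundaries[OF inf] by blast
  have nc: "\<not> computable (block E h i)" for i
    using h(4)[of i] noncomputable_block[OF E(2)] by (elim exE)
  then have "infinite (block E h i)" for i using computable_finite by blast
  then have "type6 (range (block E h))"
    unfolding type6_def
    by (intro exI[of _ "block E h"] conjI allI refl nc disjoint_family_block[OF E(2) h(1)])
  then show ?thesis using seq_generatesD[OF seq_generates_block[OF E(1) h(1-3)]] by blast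
qed

text \<open>Beyond some index \<open>M\<close> all members are finite, so any initial segment of the
  sequence is almost contained in the union \<open>V\<close> of the first \<open>M\<close>
  members.\<close>

lemma single_generator:
  assumes E: "seq_generates E A" and fin: "finite {n. infinite (E n)}"
  shows "\<exists>G. generates_D G A \<and> (type1 G \<or> type2 G \<or> type3 G)"
proof -
  obtain M where M: "\<And>n. infinite (E n) \<Longrightarrow> n < M"
    using fin finite_nat_set_iff_bounded by auto
  define V where "V = (\<Union>n<M. E n)"
  have V: "V \<in> disj_ce A"
    unfolding V_def by (rule disj_ce_UN) (use E seq_generates_def in auto)
  have gen: "D \<subseteq>\<^sup>* V" if D: "D \<in> disj_ce A" for D
  proof -
    obtain n where n: "D \<subseteq>\<^sup>* (\<Union>i<n. E i)" using E D unfolding seq_generates_def by blast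
    have "finite (\<Union>i\<in>{M..<n}. E i)" using M by (meson atLeastLessThan_iff finite_UN_I finite_atLeastLessThan not_le)
    moreover have "D - V \<subseteq> (D - (\<Union>i<n. E i)) \<union> (\<Union>i\<in>{M..<n}. E i)"
      unfolding V_def by force
    ultimately show ?thesis
      using n unfolding almost_subset_def by (meson finite_UnI finite_subset)
  qed
  show ?thesis
  \<comment> \<open>If \<open>V\<close> is finite, so is every set in \<open>disj_ce A\<close>,
    which gives type 1; otherwise computability of \<open>V\<close> decides between types 2 and
    3.\<close>
  proof (cases "finite V")
    case True
    have "D \<subseteq>\<^sup>* \<Union>{{}}" if "D \<in> disj_ce A" for D
      using gen[OF that] True unfolding almost_subset_def by simp
    then have "generates_D {{}} A"
      using computable_imp_ce[OF computable_empty]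
      by (intro generates_DI) (auto simp: disj_ce_def)
    then show ?thesis unfolding type1_def by blast
  next
    case False
    have "D \<subseteq>\<^sup>* \<Union>{V}" if "D \<in> disj_ce A" for D using gen[OF that] by simp
    then have "generates_D {V} A" using V by (intro generates_DI) blast+
    then show ?thesis unfolding type2_def type3_def using False by blast
  qed
qed

text \<open>An initial segment containing all noncomputable members is collected in
  \<open>S\<close>. The remaining computable members are grouped into blocks with exactly one
  infinite member each, which removes finite sets from the list.\<close>

lemma type4_or_5_of_disjoint_seq:
  assumes E: "seq_generates E A" "disjoint_family E" and fin: "finite {n. \<not> computable (E n)}"
    and inf: "infinite {n. infinite (E n)}"
  shows "\<exists>G. generates_D G A \<and> (type4 G \<or> type5 G)"
proof -
  obtain N where N: "\<And>n. \<not> computable (E n) \<Longrightarrow> n < N"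
    using fin finite_nat_set_iff_bounded by auto
  define S where "S = (\<Union>n<N. E n)"
  define E' where "E' i = E (N + i)" for i
  have E'c: "computable (E' i)" for i using N unfolding E'_def by fastforce
  have E'd: "disjoint_family E'"
    using E(2) unfolding E'_def disjoint_family_on_def by simp
  have "infinite {i. infinite (E' i)}"
  proof
    assume "finite {i. infinite (E' i)}"
    then have "finite ({..<N} \<union> (+) N ` {i. infinite (E' i)})" by simp
    moreover have "{n. infinite (E n)} \<subseteq> {..<N} \<union> (+) N ` {i. infinite (E' i)}"
      unfolding E'_def by (auto simp: image_iff) (metis le_add_diff_inverse not_le)
    ultimately show False using inf finite_subset by blast
  qed
  then obtain h where h: "mono h" "h 0 = 0" "\<And>n. n \<le> h n"
    "\<And>i. \<exists>s. {h i..<h (Suc i)} \<inter> {n. infinite (E' n)} = {s}"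
    using ex_block_boundaries by blast
  define R where "R = block E' h"
  have Ri: "infinite (R i)" for i using h(4)[of i] unfolding R_def by (elim exE) (rule infinite_block)
  have Rc: "computable (R i)" for i unfolding R_def by (rule computable_block) (rule E'c)
  have Rd: "disjoint_family R" unfolding R_def by (rule disjoint_family_block[OF E'd h(1)])
  have ER: "E n \<in> disj_ce A" for n using E(1) unfolding seq_generates_def by blast
  have RA: "R i \<in> disj_ce A" for i
    unfolding R_def by (rule disj_ce_block) (simp add: E'_def ER)
  have SA: "S \<in> disj_ce A" unfolding S_def by (rule disj_ce_UN) (auto simp: ER)
  have "E n \<inter> E' i = {}" if "n < N" for n i
    using that disjoint_family_onD[OF E(2), of n "N + i"] unfolding E'_def by simp
  then have "S \<inter> E' i = {}" for i unfolding S_def by blast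
  then have SR: "S \<inter> R i = {}" for i unfolding R_def block_def by blast
  have gen: "\<exists>n. D \<subseteq>\<^sup>* S \<union> (\<Union>i<n. R i)" if D: "D \<in> disj_ce A" for D
  proof -
    obtain n where n: "D \<subseteq>\<^sup>* (\<Union>i<n. E i)" using E D unfolding seq_generates_def by blast
    \<comment> \<open>Members with index below \<open>N\<close> lie in \<open>S\<close>; the others
      are shifted by \<open>N\<close>, and their new index stays below
      \<open>n \<le> h n\<close>.\<close>
    have "(\<Union>i<n. E i) \<subseteq> S \<union> (\<Union>i<h n. E' i)"
    proof
      fix x assume "x \<in> (\<Union>i<n. E i)"
      then obtain i where i: "i < n" "x \<in> E i" by blast
      show "x \<in> S \<union> (\<Union>i<h n. E' i)"
      proof (cases "i < N")
        case False
        then have "x \<in> E' (i - N)" "i - N < h n"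
          using i h(3)[of n] unfolding E'_def by auto
        then show ?thesis by blast
      qed (use i S_def in blast)
    qed
    then show ?thesis
      using almost_subset_mono[OF n] unfolding R_def UN_block[OF h(1,2)] by blast
  qed
  show ?thesis
  proof (cases "computable S")
    case True
    \<comment> \<open>\<open>S\<close> may be finite or even empty, so it is merged with the
      infinite set \<open>R 0\<close> instead of being listed separately.\<close>
    define R' where "R' = R(0 := S \<union> R 0)"
    have "infinite (R' i) \<and> computable (R' i)" for i
      unfolding R'_def using Ri Rc computable_Un[OF True] by simp
    moreover have "disjoint_family R'"
      using Rd SR unfolding R'_def disjoint_family_on_def by (auto simp: disjoint_iff)
    ultimately have "type4 (range R')"
      unfolding type4_def by (intro exI[of _ R'] conjI allI refl) auto
    moreover have "seq_generates R' A"
      unfolding seq_generates_def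
    proof (intro conjI ballI allI)
      show "R' n \<in> disj_ce A" for n unfolding R'_def using RA SA disj_ce_Un by simp
    next
      fix D assume "D \<in> disj_ce A"
      then obtain n where n: "D \<subseteq>\<^sup>* S \<union> (\<Union>i<n. R i)" using gen by blast
      have "S \<subseteq> R' 0" "\<And>i. R i \<subseteq> R' i" unfolding R'_def by auto
      then have "S \<union> (\<Union>i<n. R i) \<subseteq> (\<Union>i<Suc n. R' i)" by fastforce
      then show "\<exists>n. D \<subseteq>\<^sup>* (\<Union>i<n. R' i)" using almost_subset_mono[OF n] by blast
    qed
    ultimately show ?thesis using seq_generatesD by blast
  next
    case False
    then have "type5 (insert S (range R))"
      unfolding type5_def
      by (intro exI[of _ S] exI[of _ R] conjI allI refl Ri Rc Rd SR) (auto intro: computable_finite)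
    moreover have "generates_D (insert S (range R)) A"
    proof (rule generates_DI)
      fix D assume "D \<in> disj_ce A"
      then obtain n where "D \<subseteq>\<^sup>* S \<union> (\<Union>i<n. R i)" using gen by blast
      then show "\<exists>F. F \<subseteq> insert S (range R) \<and> finite F \<and> D \<subseteq>\<^sup>* \<Union>F"
        by (intro exI[of _ "insert S (R ` {..<n})"]) auto
    qed (use SA RA in blast)
    ultimately show ?thesis by blast
  qed
qed

section \<open>Disjoint generators from a chain of good sets\<close>

text \<open>Iterating the hypothesis yields an increasing chain of good sets that absorbs an
  enumeration of \<open>disj_ce A\<close>; its successive differences are the desired
  sequence.\<close>

lemma ex_disjoint_seq_generates:
  assumes split: "\<And>W. W \<in> disj_ce A \<Longrightarrow>
    \<exists>D\<in>disj_ce A. W \<subseteq> D \<and> (\<forall>D'\<in>disj_ce A. ce (D' - D))"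
  obtains E where "seq_generates E A" "disjoint_family E"
proof -
  obtain U :: "nat \<Rightarrow> nat set" where U: "range U = disj_ce A" using ex_disj_ce_enum[of A] ..
  have "\<exists>g. \<forall>n. (g n \<in> disj_ce A \<and> (\<forall>D'\<in>disj_ce A. ce (D' - g n))) \<and>
      g n \<union> U n \<subseteq> g (Suc n)"
  proof (rule dependent_nat_choice)
    show "\<exists>D. D \<in> disj_ce A \<and> (\<forall>D'\<in>disj_ce A. ce (D' - D))"
      using split U by (metis rangeI)
  next
    fix D n
    assume "D \<in> disj_ce A \<and> (\<forall>D'\<in>disj_ce A. ce (D' - D))"
    then have "D \<union> U n \<in> disj_ce A" using U disj_ce_Un by blast
    \<comment> \<open>Goodness need not survive the union with \<open>U n\<close>; it is restored by
      passing to a good superset.\<close>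
    then show "\<exists>V. (V \<in> disj_ce A \<and> (\<forall>D'\<in>disj_ce A. ce (D' - V))) \<and> D \<union> U n \<subseteq> V"
      using split by metis
  qed
  then obtain g where g: "\<And>n. g n \<in> disj_ce A" "\<And>n D'. D' \<in> disj_ce A \<Longrightarrow> ce (D' - g n)"
    "\<And>n. g n \<union> U n \<subseteq> g (Suc n)" by blast
  have inc: "mono g" unfolding mono_iff_le_Suc using g(3) by blast
  have "disjointed g n \<in> disj_ce A" for n
  proof (cases n)
    case 0
    then show ?thesis using g(1) by (simp add: disjointed_def)
  next
    case (Suc m)
    \<comment> \<open>Since the chain increases, only the immediate predecessor is subtracted, and
      goodness of \<open>g m\<close> says that this difference is c.e.\<close>
    have "disjointed g n = g n - g m"
      unfolding Suc by (rule disjointed_mono[OF inc])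
    then show ?thesis using g(1)[of n] g(2)[OF g(1)] unfolding disj_ce_def by auto
  qed
  moreover have "\<exists>n. D \<subseteq>\<^sup>* (\<Union>i<n. disjointed g i)" if "D \<in> disj_ce A" for D
  proof -
    obtain n where "D = U n" using U \<open>D \<in> disj_ce A\<close> by blast
    \<comment> \<open>\<open>U n\<close> is absorbed only by \<open>g (Suc n)\<close>, hence the
      bound \<open>Suc (Suc n)\<close>.\<close>
    then have "D \<subseteq> (\<Union>i<Suc (Suc n). g i)" using g(3)[of n] by blast
    also have "\<dots> = (\<Union>i<Suc (Suc n). disjointed g i)"
      using finite_UN_disjointed_eq[of g "Suc (Suc n)"] by (simp add: lessThan_atLeast0)
    finally show ?thesis using subset_imp_almost_subset by blast
  qed
  ultimately have "seq_generates (disjointed g) A" unfolding seq_generates_def by blast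
  then show thesis using that disjoint_family_disjointed by blast
qed

theorem theorem3p10:
  fixes A :: "nat set"
  assumes "ce A"
  shows "\<exists>G. generates_D G A \<and>
    (type1 G \<or> type2 G \<or> type3 G \<or> type4 G \<or> type5 G \<or>
     type6 G \<or> type7 G \<or> type8 G \<or> type9 G \<or> type10 G)"
proof (cases "\<forall>W\<in>disj_ce A. \<exists>D\<in>disj_ce A. W \<subseteq> D \<and> (\<forall>D'\<in>disj_ce A. ce (D' - D))")
  case True
  then obtain E where E: "seq_generates E A" "disjoint_family E"
    using ex_disjoint_seq_generates[of A] by blast
  \<comment> \<open>These cases lead to type 6, to types 1 to 3, and to types 4 or 5,
    respectively.\<close>
  consider "infinite {n. \<not> computable (E n)}" | "finite {n. infinite (E n)}"
    | "finite {n. \<not> computable (E n)}" "infinite {n. infinite (E n)}" by blast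
  then show ?thesis
  proof cases
    case 1
    then show ?thesis using type6_of_disjoint_seq[OF E] by blast
  next
    case 2
    then show ?thesis using single_generator[OF E(1)] by blast
  next
    case 3
    then show ?thesis using type4_or_5_of_disjoint_seq[OF E] by blast
  qed
next
  case False
  then obtain W where W: "W \<in> disj_ce A"
    "\<not> (\<exists>D\<in>disj_ce A. W \<subseteq> D \<and> (\<forall>D'\<in>disj_ce A. ce (D' - D)))"
    unfolding Ball_def by auto
  have "\<exists>D'\<in>disj_ce A. \<not> ce (D' - D)" if "D \<in> disj_ce A" "W \<subseteq> D" for D
    using W(2) that by blast
  from type10_if_no_splitting[OF W(1) this] show ?thesis by blast
qed

end
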